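(* Let $\mathfrak{M}=(V,\langle\cdot,\cdot\rangle,A)$, where $V$ is a finite-dimensional real vector space, $\langle\cdot,\cdot\rangle$ is a non-degenerate symmetric bilinear form of arbitrary signature on $V$, and $A$ is an algebraic curvature tensor on $V$. Suppose that $\mathfrak{M}$ is Jacobi--Tsankov. If $\dim(V)\le 13$, then $\mathfrak{M}$ is $2$-step Jacobi nilpotent.
   Context: An algebraic curvature tensor on $V$ is $A\in\otimes^4V^*$ with $A(x,y,z,w)=-A(y,x,z,w)=A(z,w,x,y)$ and $A(x,y,z,w)+A(y,z,x,w)+A(z,x,y,w)=0$ for all $x,y,z,w\in V$. The curvature operator $\mathcal{A}(x,y)\in\operatorname{End}(V)$ is defined by $\langle\mathcal{A}(x,y)z,w\rangle=A(x,y,z,w)$, and the Jacobi operator is $\mathcal{J}(x):y\mapsto\mathcal{A}(y,x)x$. $\mathfrak{M}$ is Jacobi--Tsankov if $\mathcal{J}(x)\mathcal{J}(y)=\mathcal{J}(y)\mathcal{J}(x)$ for all $x,y\in V$, and $2$-step Jacobi nilpotent if $\mathcal{J}(x)\mathcal{J}(y)=0$ for all $x,y\in V$. *)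

theory Defs
  imports "HOL-Analysis.Analysis"
begin

definition finite_dimensional :: "'v::real_vector itself \<Rightarrow> bool" where
  "finite_dimensional _ \<longleftrightarrow> (\<exists>B :: 'v set. finite B \<and> span B = UNIV)"

text \<open>No definiteness is assumed: the signature of the form is arbitrary.\<close>

definition nondegenerate_symmetric_form :: "('v::real_vector \<Rightarrow> 'v \<Rightarrow> real) \<Rightarrow> bool" where
  "nondegenerate_symmetric_form g \<longleftrightarrow>
     bilinear g \<and> (\<forall>x y. g x y = g y x) \<and> (\<forall>x. (\<forall>y. g x y = 0) \<longrightarrow> x = 0)"

definition quadrilinear :: "('v::real_vector \<Rightarrow> 'v \<Rightarrow> 'v \<Rightarrow> 'v \<Rightarrow> real) \<Rightarrow> bool" where
  "quadrilinear A \<longleftrightarrow>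
     (\<forall>y z w. linear (\<lambda>x. A x y z w)) \<and> (\<forall>x z w. linear (\<lambda>y. A x y z w)) \<and>
     (\<forall>x y w. linear (\<lambda>z. A x y z w)) \<and> (\<forall>x y z. linear (\<lambda>w. A x y z w))"

definition algebraic_curvature_tensor ::
    "('v::real_vector \<Rightarrow> 'v \<Rightarrow> 'v \<Rightarrow> 'v \<Rightarrow> real) \<Rightarrow> bool" where
  "algebraic_curvature_tensor A \<longleftrightarrow> quadrilinear A \<and>
     (\<forall>x y z w. A x y z w = - A y x z w) \<and>
     (\<forall>x y z w. A x y z w = A z w x y) \<and>
     (\<forall>x y z w. A x y z w + A y z x w + A z x y w = 0)"

text \<open>The vector described below exists and is unique when \<open>g\<close> is a non-degenerate symmetric
  form on a finite-dimensional space and \<open>A\<close> is linear in its last argument; see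
  \<open>curvature_operator_eq_iff\<close>.\<close>

definition curvature_operator ::
    "('v::real_vector \<Rightarrow> 'v \<Rightarrow> real) \<Rightarrow> ('v \<Rightarrow> 'v \<Rightarrow> 'v \<Rightarrow> 'v \<Rightarrow> real) \<Rightarrow> 'v \<Rightarrow> 'v \<Rightarrow> 'v \<Rightarrow> 'v" where
  "curvature_operator g A x y z = (THE u. \<forall>w. g u w = A x y z w)"

definition jacobi_operator ::
    "('v::real_vector \<Rightarrow> 'v \<Rightarrow> real) \<Rightarrow> ('v \<Rightarrow> 'v \<Rightarrow> 'v \<Rightarrow> 'v \<Rightarrow> real) \<Rightarrow> 'v \<Rightarrow> 'v \<Rightarrow> 'v" where
  "jacobi_operator g A x = (\<lambda>y. curvature_operator g A y x x)"

definition jacobi_tsankov ::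
    "('v::real_vector \<Rightarrow> 'v \<Rightarrow> real) \<Rightarrow> ('v \<Rightarrow> 'v \<Rightarrow> 'v \<Rightarrow> 'v \<Rightarrow> real) \<Rightarrow> bool" where
  "jacobi_tsankov g A \<longleftrightarrow> (\<forall>x y.
     jacobi_operator g A x \<circ> jacobi_operator g A y = jacobi_operator g A y \<circ> jacobi_operator g A x)"

definition two_step_jacobi_nilpotent ::
    "('v::real_vector \<Rightarrow> 'v \<Rightarrow> real) \<Rightarrow> ('v \<Rightarrow> 'v \<Rightarrow> 'v \<Rightarrow> 'v \<Rightarrow> real) \<Rightarrow> bool" where
  "two_step_jacobi_nilpotent g A \<longleftrightarrow>
     (\<forall>x y. jacobi_operator g A x \<circ> jacobi_operator g A y = (\<lambda>_. 0))"

lemma nondegenerate_form_represents_unique: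
  fixes g :: "'v::real_vector \<Rightarrow> 'v \<Rightarrow> real" and f :: "'v \<Rightarrow> real"
  assumes fin: "finite_dimensional TYPE('v)"
    and g: "nondegenerate_symmetric_form g" and f: "linear f"
  shows "\<exists>!u. \<forall>w. g u w = f w"
proof -
  obtain S :: "'v set" where S: "finite S" "span S = UNIV"
    using fin by (auto simp: finite_dimensional_def)
  obtain B :: "'v set" where B: "independent B" "span B = UNIV"
    by (metis real_vector.maximal_independent_subset[of UNIV] top.extremum_uniqueI)
  have finB: "finite B"
    using real_vector.independent_span_bound[OF S(1) B(1)] S(2) by auto
  interpret fd: finite_dimensional_vector_space "(*\<^sub>R) :: real \<Rightarrow> 'v \<Rightarrow> 'v" B
    by unfold_locales (use finB B in \<open>auto simp: dependent_raw_def span_raw_def\<close>)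
  have lin_l: "linear (\<lambda>x. g x w)" and lin_r: "linear (g x)" for x w
    using g by (auto simp: nondegenerate_symmetric_form_def bilinear_def)
  have nondeg: "x = 0" if "\<And>y. g x y = 0" for x
    using g that by (auto simp: nondegenerate_symmetric_form_def)
  have ext: "p w = q w" if "linear p" "linear q" "\<And>b. b \<in> B \<Longrightarrow> p b = q b"
    for p q :: "'v \<Rightarrow> real" and w
    using real_vector.linear_eq_on[OF that(1,2), of w B] that(3) B(2) by auto
  define T where "T = (\<lambda>x. \<Sum>b\<in>B. g x b *\<^sub>R b)"
  have T_diff: "T x - T y = (\<Sum>b\<in>B. (g x b - g y b) *\<^sub>R b)" for x y
    by (simp add: T_def scaleR_left_diff_distrib sum_subtractf)
  have linT: "linear T"
    unfolding T_def
    by (rule linearI)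
      (simp_all add: linear_add[OF lin_l] linear_cmul[OF lin_l] scaleR_left_distrib
        sum.distrib scaleR_sum_right)
  have "inj T"
  proof (rule injI)
    fix x y assume "T x = T y"
    then have zero: "(\<Sum>b\<in>B. (g x b - g y b) *\<^sub>R b) = 0"
      using T_diff[of x y] by simp
    have eq_B: "g x b - g y b = 0" if "b \<in> B" for b
      by (rule real_vector.independentD[where u = "\<lambda>b. g x b - g y b", OF B(1) finB subset_refl zero that])
    have "g x w = g y w" for w
      using ext[of "g x" "g y" w] lin_r eq_B by simp
    then have "g (x - y) w = 0" for w
      by (simp add: linear_diff[OF lin_l])
    then show "x = y"
      using nondeg[of "x - y"] by simp
  qed
  then have "surj T"
    using fd.linear_inj_imp_surj linT by (auto simp: linear_def)
  then obtain u where u: "T u = (\<Sum>b\<in>B. f b *\<^sub>R b)"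
    by (metis surjD)
  then have zero: "(\<Sum>b\<in>B. (g u b - f b) *\<^sub>R b) = 0"
    by (simp add: T_def scaleR_left_diff_distrib sum_subtractf)
  have eq_B: "g u b - f b = 0" if "b \<in> B" for b
    by (rule real_vector.independentD[where u = "\<lambda>b. g u b - f b", OF B(1) finB subset_refl zero that])
  have u_f: "g u w = f w" for w
    using ext[of "g u" f w] lin_r f eq_B by simp
  show ?thesis
  proof (rule ex1I[of _ u])
    show "\<forall>w. g u w = f w" using u_f by simp
    fix v assume "\<forall>w. g v w = f w"
    then have "g (v - u) w = 0" for w
      by (simp add: linear_diff[OF lin_l] u_f)
    then show "v = u"
      using nondeg[of "v - u"] by simp
  qed
qed

lemma curvature_operator_eq_iff:
  fixes g :: "'v::real_vector \<Rightarrow> 'v \<Rightarrow> real"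
  assumes "finite_dimensional TYPE('v)"
    and "nondegenerate_symmetric_form g" and "algebraic_curvature_tensor A"
  shows "curvature_operator g A x y z = u \<longleftrightarrow> (\<forall>w. g u w = A x y z w)"
proof -
  have "linear (A x y z)"
    using assms(3) by (simp add: algebraic_curvature_tensor_def quadrilinear_def)
  note ex1 = nondegenerate_form_represents_unique[OF assms(1,2) this]
  show ?thesis
    unfolding curvature_operator_def using theI'[OF ex1] the1_equality[OF ex1, of u] by metis
qed

end

theory Submission
  imports Defs
begin

text \<open>Let \<open>P x y\<close> be twice the polarised Jacobi operator, so that \<open>P x x = 2 \<J>(x)\<close>. Since
  \<open>\<J>(x)\<close> annihilates \<open>x\<close>, commutativity forces \<open>\<J>(x)\<^sup>2 = 0\<close>, and polarising this gives
  \<open>P x x \<circ> P y z + 2 P x y \<circ> P x z = 0\<close>. If \<open>\<J>(x) \<J>(y) \<noteq> 0\<close> for some \<open>x\<close>, \<open>y\<close>, then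
  \<open>d = g (P x x (P y y z)) z \<noteq> 0\<close> for some \<open>x\<close>, \<open>y\<close>, \<open>z\<close>, and \<open>d\<close> is symmetric in the three vectors.
  The products of the vectors \<open>P a b c\<close> with \<open>a, b, c \<in> {x, y, z}\<close> are then all fixed multiples of \<open>d\<close>,
  and these vectors span a space of dimension 8 on which \<open>g\<close> is non-degenerate. It is
  orthogonal to the three vectors \<open>P x x (P y y z)\<close>, \<open>P x x (P z z y)\<close>, \<open>P y y (P z z x)\<close>, which are
  isotropic, mutually orthogonal and dual to \<open>z\<close>, \<open>y\<close>, \<open>x\<close>. Hence the dimension is at least
  \<open>3 + 8 + 3 = 14\<close>.\<close>

section \<open>Linear independence from a pairing\<close>

text \<open>Only one side of the diagonal is constrained, since in the list used below the values on
  the other side, such as \<open>g x y\<close>, are unknown.\<close>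

fun triangular_pairing :: "('v \<Rightarrow> 'v \<Rightarrow> real) \<Rightarrow> ('v \<times> 'v) list \<Rightarrow> bool" where
  "triangular_pairing g [] \<longleftrightarrow> True"
| "triangular_pairing g ((v, q) # ps) \<longleftrightarrow>
     g v q \<noteq> 0 \<and> (\<forall>(w, r) \<in> set ps. g w q = 0) \<and> triangular_pairing g ps"

text \<open>Pairing with \<open>q\<close> kills the span of the later vectors but not
  \<open>v\<close>.\<close>

lemma triangular_pairing_independent:
  fixes g :: "'v::real_vector \<Rightarrow> 'v \<Rightarrow> real"
  assumes "bilinear g" and "triangular_pairing g ps"
  shows "independent (fst ` set ps) \<and> card (fst ` set ps) = length ps"
  using assms(2)
proof (induction ps)
  case Nil
  then show ?case by (simp add: real_vector.independent_empty)
next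
  case (Cons p ps)
  obtain v q where p: "p = (v, q)" by (cases p)
  have lin: "linear (\<lambda>x. g x q)"
    using assms(1) by (simp add: bilinear_def)
  have zero: "g w q = 0" if "w \<in> fst ` set ps" for w
    using Cons.prems that unfolding p by force
  have "g w q = 0" if "w \<in> span (fst ` set ps)" for w
    by (rule real_vector.linear_eq_0_on_span[OF lin zero that])
  then have notin: "v \<notin> span (fst ` set ps)"
    using Cons.prems unfolding p by auto
  have new: "v \<notin> fst ` set ps"
    using notin real_vector.span_base[of v "fst ` set ps"] by blast
  have "triangular_pairing g ps"
    using Cons.prems by (simp add: p)
  from Cons.IH[OF this] have IH: "independent (fst ` set ps)" "card (fst ` set ps) = length ps"
    by blast+
  have "card (insert v (fst ` set ps)) = Suc (length ps)"
    unfolding IH(2)[symmetric] using new by (intro card_insert_disjoint) simp_all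
  then show ?case
    using real_vector.independent_insertI[OF notin IH(1)]
    by (simp only: p list.set image_insert fst_conv length_Cons simp_thms)
qed

lemma triangular_pairing_length_le_dim:
  fixes g :: "'v::real_vector \<Rightarrow> 'v \<Rightarrow> real"
  assumes "finite_dimensional TYPE('v)" and "bilinear g" and "triangular_pairing g ps"
  shows "length ps \<le> dim (UNIV :: 'v set)"
proof -
  note ind = triangular_pairing_independent[OF assms(2,3)]
  obtain S :: "'v set" where S: "finite S" "span S = UNIV"
    using assms(1) by (auto simp: finite_dimensional_def)
  obtain B :: "'v set" where B: "fst ` set ps \<subseteq> B" "independent B" "UNIV \<subseteq> span B"
    using real_vector.maximal_independent_subset_extend[of "fst ` set ps" UNIV] ind by auto
  have "finite B"
    using real_vector.independent_span_bound[OF S(1) B(2)] S(2) by auto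
  then have "length ps \<le> card B"
    using ind B(1) card_mono by metis
  also have "card B = dim (UNIV :: 'v set)"
    using real_vector.basis_card_eq_dim[OF subset_UNIV B(3) B(2)] .
  finally show ?thesis .
qed

section \<open>The polarised Jacobi operators and their symmetries\<close>

locale jacobi_tsankov_model =
  fixes g :: "'v::real_vector \<Rightarrow> 'v \<Rightarrow> real"
    and A :: "'v \<Rightarrow> 'v \<Rightarrow> 'v \<Rightarrow> 'v \<Rightarrow> real"
  assumes fin: "finite_dimensional TYPE('v)"
    and form: "nondegenerate_symmetric_form g"
    and curv: "algebraic_curvature_tensor A"
    and tsankov: "jacobi_tsankov g A"
begin

lemma bilinear_g: "bilinear g"
  using form by (simp add: nondegenerate_symmetric_form_def)

lemma g_sym: "g x y = g y x"
  using form by (simp add: nondegenerate_symmetric_form_def)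

lemmas g_simps = bilinear_ladd[OF bilinear_g] bilinear_radd[OF bilinear_g]
  bilinear_lmul[OF bilinear_g] bilinear_rmul[OF bilinear_g]
  bilinear_lneg[OF bilinear_g] bilinear_rneg[OF bilinear_g]
  bilinear_lzero[OF bilinear_g] bilinear_rzero[OF bilinear_g]
  bilinear_lsub[OF bilinear_g] bilinear_rsub[OF bilinear_g]

lemma g_ext:
  assumes "\<And>w. g u w = g v w"
  shows "u = v"
proof -
  have "g (u - v) w = 0" for w
    using assms by (simp add: g_simps)
  then show ?thesis
    using form unfolding nondegenerate_symmetric_form_def by (metis eq_iff_diff_eq_0)
qed

lemma A_linear:
  "linear (\<lambda>x. A x y z w)" "linear (\<lambda>y. A x y z w)" "linear (\<lambda>z. A x y z w)"
proof -
  have "quadrilinear A"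
    using curv unfolding algebraic_curvature_tensor_def by blast
  then show "linear (\<lambda>x. A x y z w)" "linear (\<lambda>y. A x y z w)" "linear (\<lambda>z. A x y z w)"
    by (simp_all add: quadrilinear_def)
qed

lemmas A_simps = linear_add[OF A_linear(1)] linear_add[OF A_linear(2)] linear_add[OF A_linear(3)]
  linear_cmul[OF A_linear(1)] linear_cmul[OF A_linear(2)] linear_cmul[OF A_linear(3)]

lemma A_skew: "A x y z w = - A y x z w"
  and A_pair: "A x y z w = A z w x y"
  using curv unfolding algebraic_curvature_tensor_def by blast+

definition P :: "'v \<Rightarrow> 'v \<Rightarrow> 'v \<Rightarrow> 'v" where
  "P x y z = curvature_operator g A z x y + curvature_operator g A z y x"

lemma g_curvature_operator: "g (curvature_operator g A x y z) w = A x y z w"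
  using curvature_operator_eq_iff[OF fin form curv, of x y z] by blast

lemma g_P: "g (P x y z) w = A z x y w + A z y x w"
  by (simp add: P_def g_simps g_curvature_operator)

lemma P_sym: "P x y z = P y x z"
  by (simp add: P_def)

lemma linear_P: "linear (P x y)"
  by (rule linearI; rule g_ext; simp add: g_simps g_P A_simps algebra_simps)

lemma linear_P_left: "linear (\<lambda>x. P x y z)"
  by (rule linearI; rule g_ext; simp add: g_simps g_P A_simps algebra_simps)

lemma linear_P_middle: "linear (\<lambda>y. P x y z)"
  using linear_P_left[of x z] by (simp add: P_sym[of x])

lemmas P_simps = linear_add[OF linear_P] linear_add[OF linear_P_left] linear_add[OF linear_P_middle]
  linear_cmul[OF linear_P] linear_cmul[OF linear_P_left] linear_cmul[OF linear_P_middle]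
  linear_neg[OF linear_P] linear_neg[OF linear_P_left] linear_neg[OF linear_P_middle]
  linear_diff[OF linear_P] linear_diff[OF linear_P_left] linear_diff[OF linear_P_middle]
  linear_0[OF linear_P] linear_0[OF linear_P_left] linear_0[OF linear_P_middle]

text \<open>The six curvature terms cancel in pairs by skew-symmetry.\<close>

lemma P_cyclic: "P x y z + P y z x + P z x y = 0"
proof (rule g_ext)
  fix w
  show "g (P x y z + P y z x + P z x y) w = g 0 w"
    using A_skew[of x y z w] A_skew[of y z x w] A_skew[of z x y w] by (simp add: g_simps g_P)
qed

text \<open>Exchanging \<open>z\<close> and \<open>w\<close> in \<open>A z a b w\<close> amounts to
  exchanging \<open>a\<close> and \<open>b\<close>, over which \<open>P\<close> is
  symmetrised.\<close>

lemma P_self_adjoint: "g (P x y z) w = g z (P x y w)"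
proof -
  have "A z a b w = A w b a z" for a b
    using A_skew[of z a b w] A_pair[of a z b w] A_skew[of b w a z] by simp
  then show ?thesis
    by (simp add: g_sym[of z] g_P)
qed

lemma jacobi_operator_eq_P: "jacobi_operator g A x y = (1/2) *\<^sub>R P x x y"
  by (simp add: jacobi_operator_def P_def flip: scaleR_2)

lemma P_diag_commute: "P x x (P y y z) = P y y (P x x z)"
proof -
  have "jacobi_operator g A x (jacobi_operator g A y z) = jacobi_operator g A y (jacobi_operator g A x z)"
    using tsankov unfolding jacobi_tsankov_def by (metis comp_apply)
  then show ?thesis
    by (simp add: jacobi_operator_eq_P P_simps)
qed

lemma P_diag_add: "P (x + y) (x + y) z = P x x z + 2 *\<^sub>R P x y z + P y y z"
  by (simp add: P_simps P_sym[of y x] scaleR_2)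

lemma P_commute_aux: "P x x (P a b z) = P a b (P x x z)"
  using P_diag_commute[of x "a + b" z] P_diag_commute[of x a z] P_diag_commute[of x b z]
  unfolding P_diag_add by (simp add: P_simps)

lemma P_commute: "P a b (P c d z) = P c d (P a b z)"
  using P_commute_aux[of "a + b" c d z] P_commute_aux[of a c d z] P_commute_aux[of b c d z]
  unfolding P_diag_add by (simp add: P_simps)

text \<open>A product of commuting self-adjoint operators is self-adjoint.\<close>

lemma product_symmetric: "g (P a b (P c d z)) w = g (P a b (P c d w)) z"
  using P_self_adjoint[of a b "P c d z" w] P_self_adjoint[of c d z "P a b w"]
  by (simp add: P_commute[of c d a b w] g_sym[of z])

section \<open>Relations between products of two operators\<close>

lemma P_same [simp]: "P x x x = 0"
proof (rule g_ext)
  fix w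
  have "g (P x x x + P x x x + P x x x) w = 0"
    by (simp only: P_cyclic g_simps)
  then show "g (P x x x) w = g 0 w"
    by (simp add: g_simps)
qed

lemma P_outer: "P x y x = (- 1/2) *\<^sub>R P x x y"
proof -
  have "2 *\<^sub>R P x y x = - P x x y"
    using P_cyclic[of x x y] by (simp add: P_sym[of y x] scaleR_2 eq_neg_iff_add_eq_0 algebra_simps)
  then have "(1/2) *\<^sub>R (2 *\<^sub>R P x y x) = (1/2) *\<^sub>R (- P x x y)"
    by simp
  then show ?thesis by simp
qed

text \<open>By \<open>P_outer\<close>, \<open>P x x y\<close> is a multiple of
  \<open>P x y x\<close>; commuting \<open>P x x\<close> past \<open>P x y\<close> leaves
  \<open>P x x x = 0\<close>.\<close>

lemma P_square_zero: "P x x (P x x y) = 0"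
  using P_commute[of x x x y x] P_outer[of x y] by (simp add: P_simps)

lemma P_diag_polar_zero: "P x x (P x y z) = 0"
proof (rule g_ext)
  fix w
  \<comment> \<open>Subtracting the expanded squares at \<open>x + y\<close> and
    \<open>x - y\<close> leaves the terms odd in \<open>y\<close>.\<close>
  have sum_zero: "g (P x x (P x y z)) w + g (P y y (P x y z)) w = 0" for y
  proof -
    have "g (P (x + y) (x + y) (P (x + y) (x + y) z)) w = 0"
      and "g (P (x + - y) (x + - y) (P (x + - y) (x + - y) z)) w = 0"
      by (simp_all only: P_square_zero g_simps)
    then show ?thesis
      unfolding P_diag_add
      by (simp add: P_simps g_simps P_square_zero P_commute[of y y x x] P_commute[of x y x x]
          P_commute[of x y y y])
  qed
  \<comment> \<open>The two summands have degrees 1 and 3 in \<open>y\<close>, so doubling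
    \<open>y\<close> separates them.\<close>
  show "g (P x x (P x y z)) w = g 0 w"
    using sum_zero[of y] sum_zero[of "2 *\<^sub>R y"] by (simp add: P_simps g_simps)
qed

lemma P_polarised: "P x x (P y z w) = (- 2) *\<^sub>R P x y (P x z w)"
proof -
  \<comment> \<open>When \<open>x\<close> becomes \<open>x + y\<close> in
    \<open>P_diag_polar_zero\<close>, \<open>a\<close> and \<open>b\<close> are the parts of degree
    1 and 2 in \<open>y\<close>; the sign of \<open>y\<close> separates them.\<close>
  define a where "a = P x x (P y z w) + 2 *\<^sub>R P x y (P x z w)"
  define b where "b = P y y (P x z w) + 2 *\<^sub>R P x y (P y z w)"
  have "a + b = 0"
    using P_diag_polar_zero[of "x + y" z w] unfolding P_diag_add a_def b_def
    by (simp add: P_simps P_diag_polar_zero algebra_simps)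
  moreover have "b - a = 0"
    using P_diag_polar_zero[of "x + (- y)" z w] unfolding P_diag_add a_def b_def
    by (simp add: P_simps P_diag_polar_zero algebra_simps)
  ultimately have "2 *\<^sub>R a = 0"
    by (simp add: scaleR_2)
  then show ?thesis
    by (simp add: a_def add_eq_0_iff2)
qed

section \<open>Inner products and the dimension bound\<close>

lemma triple_product_commute: "g (P x x (P y y z)) z = g (P y y (P x x z)) z"
  by (simp add: P_commute[of x x])

text \<open>With \<open>triple_product_commute\<close> this generates all permutations of the three
  vectors.\<close>

lemma triple_product_swap: "g (P x x (P y y z)) z = g (P x x (P z z y)) y"
proof -
  have "g (P x x (P z z y)) y = - 2 * g (P x x (P y z z)) y"
    using P_outer[of z y] by (simp add: P_simps g_simps P_sym[of y z])
  also have "g (P x x (P y z z)) y = g (P x x (P y z y)) z"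
    by (rule product_symmetric)
  also have "\<dots> = - g (P x x (P y y z)) z / 2"
    using P_outer[of y z] by (simp add: P_simps g_simps)
  finally show ?thesis by simp
qed

lemma orthogonal_common: "g (P a a b) (P a c e) = 0" "g (P a a b) (P c a e) = 0"
  by (simp_all add: P_self_adjoint[of a a] P_diag_polar_zero P_sym[of c] g_simps)

lemma orthogonal_argument: "g (P a a b) (P c d a) = 0"
  by (simp add: P_self_adjoint[of a a] P_commute[of a a] P_simps g_simps)

text \<open>\<open>P b b a\<close> is a multiple of \<open>P a b b\<close>, which
  \<open>P a a\<close> annihilates.\<close>

lemma orthogonal_swap: "g (P a a b) (P b b a) = 0"
  using P_outer[of b a] P_diag_polar_zero[of a b b]
  by (simp add: P_self_adjoint[of a a] P_sym[of b a] P_simps g_simps)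

lemma orthogonal_double:
  "g (P a a (P b b c)) (P b d e) = 0" "g (P a a (P b b c)) (P d b e) = 0"
  "g (P a a (P b b c)) (P d e b) = 0"
  by (simp_all add: P_commute[of a a] orthogonal_common orthogonal_argument)

lemma orthogonal_self: "g (P a a b) a = 0" "g (P a a (P b b c)) b = 0"
proof -
  show *: "g (P a a b) a = 0" for a b
    by (simp add: P_self_adjoint[of a a] g_simps)
  show "g (P a a (P b b c)) b = 0"
    by (simp add: P_commute[of a a] *)
qed

lemmas orthogonal = orthogonal_common orthogonal_argument orthogonal_swap orthogonal_double
  orthogonal_self

lemma fourteen_le_dim:
  assumes "g (P x x (P y y z)) z \<noteq> 0"
  shows "14 \<le> dim (UNIV :: 'v set)"
proof -
  define d where "d = g (P x x (P y y z)) z"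
  have d1: "g (P x x (P y y z)) z = d" "g (P y y (P z z x)) x = d" "g (P z z (P x x y)) y = d"
    using triple_product_commute[of x y z] triple_product_swap[of y x z]
      triple_product_swap[of x y z] triple_product_commute[of x z y] by (simp_all only: d_def)
  have d2: "g (P x x (P z z y)) y = d" "g (P y y (P x x z)) z = d" "g (P z z (P y y x)) x = d"
    using d1 triple_product_commute[of x z y] triple_product_commute[of x y z]
      triple_product_commute[of y z x] by (simp_all only:)
  have d3: "g (P x x y) (P z z y) = d" "g (P z z y) (P x x y) = d" "g (P x x z) (P y y z) = d"
    "g (P y y z) (P x x z) = d" "g (P y y x) (P z z x) = d" "g (P z z x) (P y y x) = d"
    unfolding P_self_adjoint[symmetric] by (fact d1 d2)+
  have v11: "g (P x y z) (P x y z) = - d / 2"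
  proof -
    have "d = - 2 * g (P x y (P x y z)) z"
      using d1(1) by (simp add: P_polarised[of x y y] g_simps)
    then show ?thesis
      by (simp add: P_self_adjoint[of x y z] g_sym[of z])
  qed
  have v22: "g (P x z y) (P x z y) = - d / 2"
  proof -
    have "d = - 2 * g (P x z (P x z y)) y"
      using d2(1) by (simp add: P_polarised[of x z z] g_simps)
    then show ?thesis
      by (simp add: P_self_adjoint[of x z y] g_sym[of y])
  qed
  have v12: "g (P x y z) (P x z y) = d / 4"
  proof -
    have "g (P x y z) (P x z y) = g (P x y (P x z y)) z"
      by (simp only: P_self_adjoint[of x y z] g_sym[of z])
    also have "\<dots> = - g (P x x (P y z y)) z / 2"
      by (simp add: P_polarised[of x y z] g_simps)
    also have "\<dots> = d / 4"
      using d1(1) P_outer[of y z] by (simp add: P_simps g_simps)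
    finally show ?thesis .
  qed
  have flip: "g a b = 0 \<Longrightarrow> g b a = 0" for a b
    by (simp add: g_sym)
  \<comment> \<open>On \<open>P x y z\<close> and \<open>P x z y\<close> the form has matrix
    \<open>d/4\<close> times \<open>((-2, 1), (1, -2))\<close>, so
    \<open>2 *\<^sub>R P x y z + P x z y\<close> is orthogonal to \<open>P x z y\<close> and pairs
    with \<open>P x y z\<close> to \<open>- 3 * d / 4\<close>. A third vector \<open>P y z x\<close>
    would be dependent by \<open>P_cyclic\<close>.\<close>
  have "triangular_pairing g
    [(x, P y y (P z z x)), (y, P z z (P x x y)), (z, P x x (P y y z)),
     (P x x y, P z z y), (P z z y, P x x y), (P x x z, P y y z), (P y y z, P x x z),
     (P y y x, P z z x), (P z z x, P y y x), (P x y z, 2 *\<^sub>R P x y z + P x z y), (P x z y, P x z y),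
     (P y y (P z z x), x), (P z z (P x x y), y), (P x x (P y y z), z)]"
    using assms by (simp add: g_simps d1 d2 d3 v11 v12 v22 g_sym[of "P x z y" "P x y z"]
      d1[THEN trans[OF g_sym]] orthogonal orthogonal[THEN flip])
  from triangular_pairing_length_le_dim[OF fin bilinear_g this] show ?thesis
    by simp
qed

end

theorem theorem1p6:
  fixes g :: "'v::real_vector \<Rightarrow> 'v \<Rightarrow> real"
    and A :: "'v \<Rightarrow> 'v \<Rightarrow> 'v \<Rightarrow> 'v \<Rightarrow> real"
  assumes "finite_dimensional TYPE('v)"
    and "nondegenerate_symmetric_form g"
    and "algebraic_curvature_tensor A"
    and "jacobi_tsankov g A"
    and "dim (UNIV :: 'v set) \<le> 13"
  shows "two_step_jacobi_nilpotent g A"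
proof -
  interpret jacobi_tsankov_model g A
    by unfold_locales fact+
  have diag: "g (P x x (P y y z)) z = 0" for x y z
    using fourteen_le_dim[of x y z] assms(5) by fastforce
  \<comment> \<open>A symmetric bilinear form with vanishing quadratic form is zero.\<close>
  have "g (P x x (P y y z)) w = 0" for x y z w
  proof -
    have "g (P x x (P y y w)) z = g (P x x (P y y z)) w"
      by (rule product_symmetric)
    then show ?thesis
      using diag[of x y "z + w"] diag[of x y z] diag[of x y w] by (simp add: P_simps g_simps)
  qed
  then have "P x x (P y y z) = 0" for x y z
    by (intro g_ext) (simp add: g_simps)
  then show ?thesis
    by (simp add: two_step_jacobi_nilpotent_def fun_eq_iff jacobi_operator_eq_P P_simps)
qed

end
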